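(* Let $G=(V,E)$ be a finite simple bipartite graph with edge-weights $w:E\to\mathbb{Z}$, and let $\ell\in\mathbb{N}$, $\ell\ge 1$. Assume that $G$ contains an $\ell$-th smallest perfect matching $M$. Then there exists a subset of edges $F\subseteq E$ with $|F|\le \ell-1$ such that \[ w(M)=\min_{M'\in\mathcal{M}_G\,:\,F\subseteq M'} w(M'). \]
   Context: For $X\subseteq E$, $w(X)=\sum_{e\in X}w(e)$. $\mathcal{M}_G$ denotes the set of all perfect matchings of $G$. The $\ell$-th smallest perfect matchings are defined recursively: the $1$st-smallest perfect matchings are exactly the minimum-weight perfect matchings of $G$; for $\ell\ge 2$, a perfect matching is $\ell$-th smallest if and only if it has minimum weight among all perfect matchings that are not $\ell'$-th smallest for any $\ell'<\ell$. *)

theory Defs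
  imports Main
begin

definition simple_graph :: "'a set \<Rightarrow> 'a set set \<Rightarrow> bool" where
  "simple_graph V E \<longleftrightarrow> finite V \<and> (\<forall>e\<in>E. e \<subseteq> V \<and> card e = 2)"

definition bipartite :: "'a set \<Rightarrow> 'a set set \<Rightarrow> bool" where
  "bipartite V E \<longleftrightarrow>
    (\<exists>A B. A \<union> B = V \<and> A \<inter> B = {} \<and> (\<forall>e\<in>E. \<exists>a\<in>A. \<exists>b\<in>B. e = {a, b}))"

definition matching :: "'a set set \<Rightarrow> 'a set set \<Rightarrow> bool" where
  "matching E M \<longleftrightarrow> M \<subseteq> E \<and> pairwise disjnt M"

definition perfect_matchings :: "'a set \<Rightarrow> 'a set set \<Rightarrow> 'a set set set" where
  "perfect_matchings V E = {M. matching E M \<and> \<Union>M = V}"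

definition weight :: "('e \<Rightarrow> int) \<Rightarrow> 'e set \<Rightarrow> int" where
  "weight w X = (\<Sum>e\<in>X. w e)"

definition min_weight_members :: "('e \<Rightarrow> int) \<Rightarrow> 'e set set \<Rightarrow> 'e set set" where
  "min_weight_members w \<M> = {M \<in> \<M>. \<forall>M'\<in>\<M>. weight w M \<le> weight w M'}"

(* Ranks start at 1; rank 0 is a dummy. For l = 1 the removed union is empty, so the
   first class consists of the minimum-weight perfect matchings. Matchings of equal
   weight share a rank, and the class is empty once all perfect matchings have one. *)
function lth_smallest_pms ::
    "'a set \<Rightarrow> 'a set set \<Rightarrow> ('a set \<Rightarrow> int) \<Rightarrow> nat \<Rightarrow> 'a set set set" where
  "lth_smallest_pms V E w l =
    (if l = 0 then {}
     else min_weight_members w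
       (perfect_matchings V E - (\<Union>l'\<in>{1..<l}. lth_smallest_pms V E w l')))"
  by auto
termination
  by (relation "measure (\<lambda>(V, E, w, l). l)") auto

declare lth_smallest_pms.simps [simp del]

end

theory Submission
  imports Defs
begin

text \<open>If a perfect matching \<open>M\<close> is covered by minimum-weight perfect matchings
  \<open>N\<^sub>1, \<dots>, N\<^sub>k\<close>, then \<open>N\<^sub>1 + \<dots> + N\<^sub>k - M\<close> is a \<open>(k - 1)\<close>-regular bipartite multigraph, hence a sum of
  \<open>k - 1\<close> perfect matchings; comparing weights shows that \<open>M\<close> has minimum weight as well.
  So a matching \<open>M\<close> that is not of minimum weight has an edge lying in no minimum-weight perfect
  matching, and forcing this edge removes the smallest weight value. An \<open>l\<close>-th smallest
  perfect matching has at most \<open>l - 1\<close> weight values below its own, so at most \<open>l - 1\<close> forced edges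
  make it minimum.\<close>

section \<open>Hall's marriage theorem\<close>

text \<open>Halmos-Vaughan induction on \<open>card A\<close>: a tight proper nonempty
  \<open>S\<close>, one with exactly \<open>card S\<close> neighbours, splits the problem in two;
  without such an \<open>S\<close>, any choice for one element leaves Hall's condition
  intact.\<close>

lemma hall_marriage:
  assumes "finite A" and "\<And>a. a \<in> A \<Longrightarrow> finite (G a)"
    and "\<And>S. S \<subseteq> A \<Longrightarrow> card S \<le> card (\<Union>a\<in>S. G a)"
  shows "\<exists>f. inj_on f A \<and> (\<forall>a\<in>A. f a \<in> G a)"
  using assms
proof (induction "card A" arbitrary: A G rule: less_induct)
  case less
  note fin = less.prems(1) and finG = less.prems(2) and hall = less.prems(3)
  show ?case
  proof (cases "\<exists>S. S \<subset> A \<and> S \<noteq> {} \<and> card (\<Union>a\<in>S. G a) = card S")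
    case True
    then obtain S where S: "S \<subset> A" "S \<noteq> {}" "card (\<Union>a\<in>S. G a) = card S" by blast
    let ?U = "\<Union>a\<in>S. G a"
    have finS: "finite S" using S(1) fin by (meson finite_subset psubset_imp_subset)
    have "\<exists>f. inj_on f S \<and> (\<forall>a\<in>S. f a \<in> G a)"
      by (rule less.hyps) (use S(1) fin finS finG hall in \<open>auto intro: psubset_card_mono\<close>)
    then obtain f where f: "inj_on f S" "\<forall>a\<in>S. f a \<in> G a" by blast
    \<comment> \<open>The values in \<open>?U\<close> are reserved for \<open>f\<close>, so the
      elements outside \<open>S\<close> are sent outside \<open>?U\<close>.\<close>
    have "\<exists>g. inj_on g (A - S) \<and> (\<forall>a\<in>A - S. g a \<in> G a - ?U)"
    proof (rule less.hyps)
      show "card (A - S) < card A" using S fin by (intro psubset_card_mono) auto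
      show "finite (A - S)" using fin by simp
      show "finite (G a - ?U)" if "a \<in> A - S" for a using that finG by auto
      fix T assume T: "T \<subseteq> A - S"
      have finT: "finite T" using T fin by (meson finite_Diff finite_subset)
      \<comment> \<open>Hall's condition for \<open>T \<union> S\<close> minus the equality
        \<open>card ?U = card S\<close> is Hall's condition for \<open>T\<close> with
        \<open>?U\<close> removed.\<close>
      have "card T + card S = card (T \<union> S)"
        using T finT finS by (subst card_Un_disjoint) auto
      also have "\<dots> \<le> card (\<Union>a\<in>T \<union> S. G a)" using T S by (intro hall) auto
      also have "(\<Union>a\<in>T \<union> S. G a) = (\<Union>a\<in>T. G a - ?U) \<union> ?U" by auto
      also have "card \<dots> \<le> card (\<Union>a\<in>T. G a - ?U) + card ?U" by (rule card_Un_le)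
      finally show "card T \<le> card (\<Union>a\<in>T. G a - ?U)" using S(3) by simp
    qed
    then obtain g where g: "inj_on g (A - S)" "\<forall>a\<in>A - S. g a \<in> G a - ?U" by blast
    let ?h = "\<lambda>a. if a \<in> S then f a else g a"
    have "f ` S \<inter> g ` (A - S) = {}" using f(2) g(2) by fastforce
    then have "inj_on ?h (S \<union> (A - S))"
      by (rule inj_on_disjoint_Un[OF f(1) g(1)])
    then have "inj_on ?h A" using S(1) by (simp add: Un_absorb1 psubset_imp_subset)
    moreover have "\<forall>a\<in>A. ?h a \<in> G a" using f g by auto
    ultimately show ?thesis by blast
  next
    case False
    show ?thesis
    proof (cases "A = {}")
      case True
      then show ?thesis by simp
    next
      case nonempty: False
      then obtain a where a: "a \<in> A" by blast
      have "card {a} \<le> card (\<Union>a\<in>{a}. G a)" using a by (intro hall) auto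
      then have "G a \<noteq> {}" by auto
      then obtain b where b: "b \<in> G a" by blast
      have "\<exists>g. inj_on g (A - {a}) \<and> (\<forall>x\<in>A - {a}. g x \<in> G x - {b})"
      proof (rule less.hyps)
        show "card (A - {a}) < card A" using a fin by (intro psubset_card_mono) auto
        show "finite (A - {a})" using fin by simp
        show "finite (G x - {b})" if "x \<in> A - {a}" for x using that finG by auto
        fix T assume T: "T \<subseteq> A - {a}"
        show "card T \<le> card (\<Union>x\<in>T. G x - {b})"
        proof (cases "T = {}")
          case True
          then show ?thesis by simp
        next
          case Tne: False
          have "T \<subset> A" using T a by auto
          \<comment> \<open>No proper nonempty subset is tight, so the strict inequality makes up
            for the loss of \<open>b\<close>.\<close>
          then have "card T < card (\<Union>x\<in>T. G x)"
            using False Tne hall[of T] by (metis le_neq_implies_less psubset_imp_subset)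
          moreover have "(\<Union>x\<in>T. G x - {b}) = (\<Union>x\<in>T. G x) - {b}" by auto
          moreover have "card (\<Union>x\<in>T. G x) - 1 \<le> card ((\<Union>x\<in>T. G x) - {b})"
            by (simp add: card_Diff_singleton_if)
          ultimately show ?thesis by simp
        qed
      qed
      then obtain g where g: "inj_on g (A - {a})" "\<forall>x\<in>A - {a}. g x \<in> G x - {b}" by blast
      have "inj_on (g(a := b)) A"
        using g by (auto simp: inj_on_def)
      moreover have "\<forall>x\<in>A. (g(a := b)) x \<in> G x" using g b by auto
      ultimately show ?thesis by blast
    qed
  qed
qed

section \<open>Basic facts on graphs and perfect matchings\<close>

lemma simple_graph_finite_edges: "simple_graph V E \<Longrightarrow> finite E"
  unfolding simple_graph_def by (meson PowI finite_Pow_iff finite_subset subsetI)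

lemma simple_graph_mono: "simple_graph V E \<Longrightarrow> E' \<subseteq> E \<Longrightarrow> simple_graph V E'"
  unfolding simple_graph_def by (meson subsetD)

lemma bipartite_mono: "bipartite V E \<Longrightarrow> E' \<subseteq> E \<Longrightarrow> bipartite V E'"
  unfolding bipartite_def by (elim ex_forward conj_forward; meson subsetD)

lemma perfect_matchings_subset: "N \<in> perfect_matchings V E \<Longrightarrow> N \<subseteq> E"
  unfolding perfect_matchings_def matching_def by blast

lemma perfect_matchings_mono:
  "N \<in> perfect_matchings V E' \<Longrightarrow> E' \<subseteq> E \<Longrightarrow> N \<in> perfect_matchings V E"
  unfolding perfect_matchings_def matching_def by blast

lemma perfect_matching_edge_unique:
  "\<lbrakk>N \<in> perfect_matchings V E; e \<in> N; f \<in> N; v \<in> e; v \<in> f\<rbrakk> \<Longrightarrow> e = f"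
  unfolding perfect_matchings_def matching_def pairwise_def disjnt_def by blast

lemma finite_perfect_matchings: "finite E \<Longrightarrow> finite (perfect_matchings V E)"
  by (rule finite_subset[of _ "Pow E"]) (auto dest: perfect_matchings_subset)

text \<open>The indicator of a perfect matching is a multiplicity function of constant degree 1;
  adding or subtracting it shifts the degree of a regular multigraph by one.\<close>

lemma perfect_matching_degree:
  assumes "finite E" "N \<in> perfect_matchings V E" "v \<in> V"
  shows "(\<Sum>e | e \<in> E \<and> v \<in> e. of_bool (e \<in> N)) = (1::nat)"
proof -
  obtain e where e: "e \<in> N" "v \<in> e"
    using assms(2,3) unfolding perfect_matchings_def by blast
  have "{e. e \<in> E \<and> v \<in> e} \<inter> N = {e}"
    using e perfect_matchings_subset[OF assms(2)] perfect_matching_edge_unique[OF assms(2)] by blast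
  then show ?thesis
    using assms(1) by (simp add: of_bool_def sum.If_cases Int_def)
qed

lemma weight_eq_indicator_sum:
  assumes "finite E" "N \<subseteq> E"
  shows "weight w N = (\<Sum>e\<in>E. of_bool (e \<in> N) * w e)"
proof -
  have "(\<Sum>e\<in>E. of_bool (e \<in> N) * w e) = (\<Sum>e\<in>E. if e \<in> N then w e else 0)"
    by (rule sum.cong) auto
  also have "\<dots> = (\<Sum>e\<in>E \<inter> N. w e)"
    using assms(1) by (simp add: sum.inter_restrict)
  finally show ?thesis using assms(2) by (simp add: weight_def Int_absorb1)
qed

section \<open>Regular bipartite multigraphs\<close>

text \<open>Here and below \<open>c e\<close> is the multiplicity of the edge \<open>e\<close> in a multigraph.\<close>

lemma regular_double_count:
  fixes c :: "'a set \<Rightarrow> nat"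
  assumes "finite V" "finite E" "S \<subseteq> V"
    and "\<And>v. v \<in> V \<Longrightarrow> (\<Sum>e | e \<in> E \<and> v \<in> e. c e) = k"
  shows "k * card S = (\<Sum>e\<in>E. c e * card (e \<inter> S))"
proof -
  have finS: "finite S" using assms(1,3) by (rule rev_finite_subset)
  \<comment> \<open>Incidences between \<open>S\<close> and the edges are counted with multiplicity,
    by vertex and then by edge.\<close>
  have "k * card S = (\<Sum>v\<in>S. \<Sum>e | e \<in> E \<and> v \<in> e. c e)"
    using assms(3,4) by (simp add: subset_eq mult.commute)
  also have "\<dots> = (\<Sum>e\<in>E. \<Sum>v | v \<in> S \<and> v \<in> e. c e)"
    by (rule sum.swap_restrict[OF finS assms(2)])
  also have "\<dots> = (\<Sum>e\<in>E. c e * card (e \<inter> S))"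
    by (rule sum.cong) (auto simp: Int_def conj_commute)
  finally show ?thesis .
qed

text \<open>Counting edge ends turns regularity into Hall's condition, and also into
  \<open>card B \<le> card A\<close>, which makes the injection from \<open>A\<close> onto
  \<open>B\<close>.\<close>

lemma regular_bipartite_perfect_matching:
  fixes c :: "'a set \<Rightarrow> nat"
  assumes graph: "simple_graph V E" and bip: "bipartite V E" and "k > 0"
    and reg: "\<And>v. v \<in> V \<Longrightarrow> (\<Sum>e | e \<in> E \<and> v \<in> e. c e) = k"
  shows "\<exists>N \<in> perfect_matchings V E. \<forall>e\<in>N. c e > 0"
proof -
  have finV: "finite V" using graph unfolding simple_graph_def by simp
  have finE: "finite E" using graph by (rule simple_graph_finite_edges)
  obtain A B where AB: "A \<union> B = V" "A \<inter> B = {}"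
    and edges_all: "\<forall>e\<in>E. \<exists>a\<in>A. \<exists>b\<in>B. e = {a, b}"
    using bip unfolding bipartite_def by (elim exE conjE) (rule that)
  have edges: "\<exists>a\<in>A. \<exists>b\<in>B. e = {a, b}" if "e \<in> E" for e
    using edges_all that by (rule bspec)
  have finA: "finite A" and finB: "finite B" using finV AB(1) by auto
  \<comment> \<open>By double counting it suffices to compare edge by edge how often
    \<open>S\<close> and \<open>T\<close> are met. Edges of multiplicity 0 contribute nothing, and
    the factor \<open>k > 0\<close> cancels.\<close>
  have card_le: "card S \<le> card T"
    if "S \<subseteq> V" "T \<subseteq> V" "\<And>e. e \<in> E \<Longrightarrow> c e > 0 \<Longrightarrow> card (e \<inter> S) \<le> card (e \<inter> T)" for S T
  proof -
    have "k * card S = (\<Sum>e\<in>E. c e * card (e \<inter> S))"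
      using regular_double_count[OF finV finE that(1) reg] by simp
    also have "\<dots> \<le> (\<Sum>e\<in>E. c e * card (e \<inter> T))"
      using that(3) by (intro sum_mono) (metis gr0I mult_le_mono2 mult_zero_left order_refl)
    also have "\<dots> = k * card T"
      using regular_double_count[OF finV finE that(2) reg] by simp
    finally show ?thesis using \<open>k > 0\<close> by simp
  qed
  \<comment> \<open>Only edges of positive multiplicity give neighbours, so the matching found lies
    in the support of \<open>c\<close>.\<close>
  let ?G = "\<lambda>a. {b \<in> B. {a, b} \<in> E \<and> c {a, b} > 0}"
  have "\<exists>f. inj_on f A \<and> (\<forall>a\<in>A. f a \<in> ?G a)"
  proof (rule hall_marriage)
    show "finite A" by (rule finA)
    show "finite (?G a)" for a using finB by simp
    fix S assume S: "S \<subseteq> A"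
    show "card S \<le> card (\<Union>a\<in>S. ?G a)"
    proof (rule card_le)
      show "S \<subseteq> V" "(\<Union>a\<in>S. ?G a) \<subseteq> V" using S AB by auto
      fix e assume e: "e \<in> E" "c e > 0"
      obtain a b where ab: "a \<in> A" "b \<in> B" "e = {a, b}"
        using edges[OF e(1)] by blast
      show "card (e \<inter> S) \<le> card (e \<inter> (\<Union>a\<in>S. ?G a))"
      proof (cases "a \<in> S")
        case True
        have "e \<inter> S = {a}" "e \<inter> (\<Union>a\<in>S. ?G a) = {b}" using True ab e S AB(2) by auto
        then show ?thesis by simp
      next
        case False
        then have "e \<inter> S = {}" using ab S AB(2) by auto
        then show ?thesis by simp
      qed
    qed
  qed
  then obtain f where inj: "inj_on f A" and f: "\<And>a. a \<in> A \<Longrightarrow> f a \<in> ?G a" by blast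
  have "card B \<le> card A"
  proof (rule card_le)
    show "B \<subseteq> V" "A \<subseteq> V" using AB by auto
    fix e assume "e \<in> E"
    then obtain a b where ab: "a \<in> A" "b \<in> B" "e = {a, b}" using edges[of e] by blast
    have "e \<inter> B = {b}" "e \<inter> A = {a}" using ab AB(2) by auto
    then show "card (e \<inter> B) \<le> card (e \<inter> A)" by simp
  qed
  then have surj: "f ` A = B"
    using f finB by (intro card_seteq) (auto simp: card_image[OF inj])
  let ?N = "(\<lambda>a. {a, f a}) ` A"
  have "?N \<subseteq> E" "\<forall>e\<in>?N. c e > 0" using f by auto
  moreover have "pairwise disjnt ?N"
  proof (rule pairwiseI)
    fix x y assume xy: "x \<in> ?N" "y \<in> ?N" "x \<noteq> y"
    then obtain a a' where a: "a \<in> A" "x = {a, f a}" "a' \<in> A" "y = {a', f a'}" by blast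
    have "a \<noteq> a'" using a xy(3) by blast
    then have "f a \<noteq> f a'" using inj a by (simp add: inj_on_eq_iff)
    moreover have "f a \<in> B" "f a' \<in> B" using f a by auto
    ultimately show "disjnt x y" using a \<open>a \<noteq> a'\<close> AB(2) by (auto simp: disjnt_def)
  qed
  moreover have "\<Union>?N = V" using surj AB(1) by auto
  ultimately show ?thesis unfolding perfect_matchings_def matching_def by blast
qed

text \<open>A \<open>k\<close>-regular bipartite multigraph splits into \<open>k\<close> perfect
  matchings, each of weight at least \<open>m\<close>; the induction peels them off one at a
  time.\<close>

lemma regular_weight_lower_bound:
  fixes c :: "'a set \<Rightarrow> nat"
  assumes graph: "simple_graph V E" and bip: "bipartite V E"
    and lower: "\<And>N. N \<in> perfect_matchings V E \<Longrightarrow> m \<le> weight w N"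
    and "\<And>v. v \<in> V \<Longrightarrow> (\<Sum>e | e \<in> E \<and> v \<in> e. c e) = k"
  shows "int k * m \<le> (\<Sum>e\<in>E. int (c e) * w e)"
  using assms(4)
proof (induction k arbitrary: c)
  case 0
  have finE: "finite E" using graph by (rule simple_graph_finite_edges)
  have "c e = 0" if "e \<in> E" for e
  proof -
    \<comment> \<open>An edge has an endpoint in \<open>V\<close>, where degree 0 forces its
      multiplicity to vanish.\<close>
    have "e \<noteq> {}" "e \<subseteq> V" using that graph unfolding simple_graph_def by auto
    then obtain v where "v \<in> e" "v \<in> V" by blast
    then show ?thesis using 0[of v] that finE by simp
  qed
  then show ?case by simp
next
  case (Suc k)
  have finE: "finite E" using graph by (rule simple_graph_finite_edges)
  obtain N where N: "N \<in> perfect_matchings V E" and pos: "\<And>e. e \<in> N \<Longrightarrow> c e > 0"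
    using regular_bipartite_perfect_matching[OF graph bip, of "Suc k" c] Suc.prems by blast
  define d where "d e = c e - of_bool (e \<in> N)" for e
  \<comment> \<open>The natural subtraction is not truncated, since \<open>c\<close> is positive on
    \<open>N\<close>.\<close>
  have c_eq: "c e = d e + of_bool (e \<in> N)" for e
    using pos[of e] by (cases "e \<in> N") (auto simp: d_def)
  have "(\<Sum>e | e \<in> E \<and> v \<in> e. d e) = k" if "v \<in> V" for v
    using Suc.prems[OF that] perfect_matching_degree[OF finE N that]
    by (simp only: c_eq sum.distrib)
  then have "int k * m \<le> (\<Sum>e\<in>E. int (d e) * w e)" by (rule Suc.IH)
  moreover have "m \<le> (\<Sum>e\<in>E. of_bool (e \<in> N) * w e)"
    using lower[OF N] weight_eq_indicator_sum[OF finE perfect_matchings_subset[OF N]] by simp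
  moreover have "(\<Sum>e\<in>E. int (c e) * w e) =
      (\<Sum>e\<in>E. int (d e) * w e) + (\<Sum>e\<in>E. of_bool (e \<in> N) * w e)"
    by (simp only: c_eq of_nat_add of_nat_of_bool distrib_right sum.distrib)
  ultimately show ?case by (simp add: distrib_right)
qed

section \<open>Matchings covered by minimum-weight matchings\<close>

text \<open>The members of \<open>\<N>\<close> weigh \<open>card \<N> * m\<close> together. Taking
  \<open>M\<close> out of their sum leaves a regular multigraph of degree
  \<open>card \<N> - 1\<close>, of weight at least \<open>(card \<N> - 1) * m\<close>, so at most
  \<open>m\<close> remains for \<open>M\<close>.\<close>

lemma weight_le_if_covered:
  assumes graph: "simple_graph V E" and bip: "bipartite V E"
    and NN: "\<N> \<subseteq> perfect_matchings V E"
    and weights: "\<And>N. N \<in> \<N> \<Longrightarrow> weight w N = m"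
    and M: "M \<in> perfect_matchings V E" and cover: "M \<subseteq> \<Union>\<N>" "\<N> \<noteq> {}"
    and lower: "\<And>N. N \<in> perfect_matchings V E \<Longrightarrow> m \<le> weight w N"
  shows "weight w M \<le> m"
proof -
  have finE: "finite E" using graph by (rule simple_graph_finite_edges)
  have finN: "finite \<N>" using NN finite_perfect_matchings[OF finE] by (rule finite_subset)
  define s where "s e = (\<Sum>N\<in>\<N>. of_bool (e \<in> N) :: nat)" for e
  define d where "d e = s e - of_bool (e \<in> M)" for e
  \<comment> \<open>The cover ensures that \<open>s\<close> counts each edge of \<open>M\<close> at
    least once, so the subtraction is exact.\<close>
  have s_eq: "s e = d e + of_bool (e \<in> M)" for e
  proof (cases "e \<in> M")
    case True
    then obtain N where "N \<in> \<N>" "e \<in> N" using cover by blast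
    then have "s e \<noteq> 0" using finN by (auto simp: s_def)
    then show ?thesis by (simp add: d_def)
  qed (simp add: d_def)
  have deg_s: "(\<Sum>e | e \<in> E \<and> v \<in> e. s e) = card \<N>" if "v \<in> V" for v
  proof -
    have "(\<Sum>e | e \<in> E \<and> v \<in> e. s e) = (\<Sum>N\<in>\<N>. \<Sum>e | e \<in> E \<and> v \<in> e. of_bool (e \<in> N))"
      unfolding s_def by (rule sum.swap)
    also have "\<dots> = (\<Sum>N\<in>\<N>. 1)"
      using NN that by (intro sum.cong refl perfect_matching_degree[OF finE]) auto
    finally show ?thesis by simp
  qed
  have "(\<Sum>e | e \<in> E \<and> v \<in> e. d e) = card \<N> - 1" if "v \<in> V" for v
    using deg_s[OF that] perfect_matching_degree[OF finE M that]
    by (simp only: s_eq sum.distrib)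
  then have "int (card \<N> - 1) * m \<le> (\<Sum>e\<in>E. int (d e) * w e)"
    using regular_weight_lower_bound[OF graph bip, of m w d "card \<N> - 1"] lower by blast
  moreover have "(\<Sum>e\<in>E. int (s e) * w e) = (\<Sum>e\<in>E. int (d e) * w e) + weight w M"
    unfolding weight_eq_indicator_sum[OF finE perfect_matchings_subset[OF M]]
    by (simp only: s_eq of_nat_add of_nat_of_bool distrib_right sum.distrib)
  moreover have "(\<Sum>e\<in>E. int (s e) * w e) = int (card \<N>) * m"
  proof -
    have "(\<Sum>e\<in>E. int (s e) * w e) = (\<Sum>e\<in>E. \<Sum>N\<in>\<N>. of_bool (e \<in> N) * w e)"
      by (simp add: s_def sum_distrib_right)
    also have "\<dots> = (\<Sum>N\<in>\<N>. \<Sum>e\<in>E. of_bool (e \<in> N) * w e)" by (rule sum.swap)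
    also have "\<dots> = (\<Sum>N\<in>\<N>. m)"
    proof (rule sum.cong[OF refl])
      fix N assume "N \<in> \<N>"
      then show "(\<Sum>e\<in>E. of_bool (e \<in> N) * w e) = m"
        using weight_eq_indicator_sum[OF finE, of N w] perfect_matchings_subset[of N] NN weights by auto
    qed
    finally show ?thesis by simp
  qed
  \<comment> \<open>\<open>\<N>\<close> is nonempty, so \<open>card \<N> - 1\<close> is a true
    predecessor.\<close>
  moreover have "card \<N> = Suc (card \<N> - 1)"
    using finN cover(2) by (simp add: card_gt_0_iff)
  then have "int (card \<N>) * m = int (card \<N> - 1) * m + m"
    by (metis add.commute distrib_right mult_1 of_nat_Suc)
  ultimately show ?thesis by linarith
qed

section \<open>Forcing edges\<close>

lemma min_weight_members_exists:
  assumes "finite \<M>" "\<M> \<noteq> {}"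
  shows "min_weight_members w \<M> \<noteq> {}"
proof -
  have "Min (weight w ` \<M>) \<in> weight w ` \<M>" using assms by (intro Min_in) auto
  then obtain N where "N \<in> \<M>" "weight w N = Min (weight w ` \<M>)" by auto
  then have "N \<in> min_weight_members w \<M>"
    using assms(1) by (auto simp: min_weight_members_def)
  then show ?thesis by blast
qed

text \<open>Otherwise the minimizers cover \<open>M\<close>. In the subgraph formed by their edges
  every perfect matching contains \<open>F\<close>, so the covering bound applies there and makes
  \<open>M\<close> a minimizer.\<close>

lemma edge_outside_min_weight_members:
  assumes graph: "simple_graph V E" and bip: "bipartite V E"
    and M: "M \<in> perfect_matchings V E" "F \<subseteq> M"
    and notmin: "M \<notin> min_weight_members w {N \<in> perfect_matchings V E. F \<subseteq> N}"
  shows "\<exists>e\<in>M. \<forall>N\<in>min_weight_members w {N \<in> perfect_matchings V E. F \<subseteq> N}. e \<notin> N"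
proof (rule ccontr)
  let ?P = "{N \<in> perfect_matchings V E. F \<subseteq> N}"
  let ?N = "min_weight_members w ?P"
  assume "\<not> ?thesis"
  then have cover: "M \<subseteq> \<Union>?N" by blast
  have finP: "finite ?P"
    using finite_perfect_matchings[OF simple_graph_finite_edges[OF graph]] by simp
  have "?N \<noteq> {}" using finP M by (intro min_weight_members_exists) auto
  then obtain N\<^sub>0 where N\<^sub>0: "N\<^sub>0 \<in> ?N" by blast
  have sub: "\<Union>?N \<subseteq> E" by (auto simp: min_weight_members_def dest: perfect_matchings_subset)
  have in_union: "N \<in> perfect_matchings V (\<Union>?N)"
    if "N \<in> perfect_matchings V E" "N \<subseteq> \<Union>?N" for N
    using that unfolding perfect_matchings_def matching_def by blast
  \<comment> \<open>The edge of \<open>N\<close> at an endpoint of \<open>f \<in> F\<close> lies in a minimizer, which contains \<open>f\<close>;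
    so that edge is \<open>f\<close> itself.\<close>
  have forced: "F \<subseteq> N" if N: "N \<in> perfect_matchings V (\<Union>?N)" for N
  proof
    fix f assume f: "f \<in> F"
    have "f \<in> E" using f M perfect_matchings_subset by blast
    then have "f \<subseteq> V" "f \<noteq> {}" using graph unfolding simple_graph_def by auto
    then obtain v where v: "v \<in> f" "v \<in> V" by blast
    then obtain e where e: "e \<in> N" "v \<in> e" using N unfolding perfect_matchings_def by blast
    obtain N' where N': "N' \<in> ?N" "e \<in> N'" using perfect_matchings_subset[OF N] e by blast
    then have "e = f"
      using perfect_matching_edge_unique[of N' V E e f v] f e v
      by (auto simp: min_weight_members_def)
    then show "f \<in> N" using e by simp
  qed
  \<comment> \<open>The bound is used in the graph with edge set \<open>\<Union>?N\<close> rather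
    than \<open>E\<close>, since perfect matchings in \<open>E\<close> that omit part of
    \<open>F\<close> may be lighter than \<open>N\<^sub>0\<close>.\<close>
  have "weight w M \<le> weight w N\<^sub>0"
  proof (rule weight_le_if_covered)
    show "simple_graph V (\<Union>?N)" "bipartite V (\<Union>?N)"
      using simple_graph_mono[OF graph sub] bipartite_mono[OF bip sub] by simp_all
    show "?N \<subseteq> perfect_matchings V (\<Union>?N)"
      using in_union by (auto simp: min_weight_members_def)
    show "weight w N = weight w N\<^sub>0" if "N \<in> ?N" for N
      using that N\<^sub>0 by (force simp: min_weight_members_def)
    show "M \<in> perfect_matchings V (\<Union>?N)" using M cover by (intro in_union)
    show "M \<subseteq> \<Union>?N" by (rule cover)
    show "?N \<noteq> {}" by fact
    show "weight w N\<^sub>0 \<le> weight w N" if "N \<in> perfect_matchings V (\<Union>?N)" for N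
      using N\<^sub>0 forced[OF that] perfect_matchings_mono[OF that sub]
      by (auto simp: min_weight_members_def)
  qed
  then have "M \<in> ?N" using N\<^sub>0 M by (auto simp: min_weight_members_def intro: order_trans)
  with notmin show False by contradiction
qed

text \<open>Induction on the number of weight values below that of \<open>M\<close> attained by
  perfect matchings containing \<open>F\<close>. Each new edge avoids all current minimizers, so it
  removes at least the smallest value, which pays for the edge.\<close>

lemma forcing_edges_exist:
  assumes graph: "simple_graph V E" and bip: "bipartite V E"
    and M: "M \<in> perfect_matchings V E" and "F \<subseteq> M"
  shows "\<exists>F'\<subseteq>M. card F' \<le> card F +
      card {x \<in> weight w ` {N \<in> perfect_matchings V E. F \<subseteq> N}. x < weight w M} \<and>
    M \<in> min_weight_members w {N \<in> perfect_matchings V E. F' \<subseteq> N}"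
proof -
  let ?P = "\<lambda>F. {N \<in> perfect_matchings V E. F \<subseteq> N}"
  let ?W = "\<lambda>F. {x \<in> weight w ` ?P F. x < weight w M}"
  have finP: "finite (?P F)" for F
    using finite_perfect_matchings[OF simple_graph_finite_edges[OF graph]] by simp
  have finW: "finite (?W F)" for F using finP[of F] by auto
  show ?thesis using \<open>F \<subseteq> M\<close>
  proof (induction "card (?W F)" arbitrary: F rule: less_induct)
    case less
    show ?case
    proof (cases "M \<in> min_weight_members w (?P F)")
      case True
      then show ?thesis using less.prems by (intro exI[of _ F]) simp
    next
      case False
      obtain e where e: "e \<in> M" "\<And>N. N \<in> min_weight_members w (?P F) \<Longrightarrow> e \<notin> N"
        using edge_outside_min_weight_members[OF graph bip M less.prems False] by blast
      have "?P F \<noteq> {}" using M less.prems by blast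
      then obtain N where N: "N \<in> min_weight_members w (?P F)"
        using min_weight_members_exists[OF finP[of F]] by blast
      have min: "weight w N \<le> weight w N'" if "N' \<in> ?P F" for N'
        using N that by (simp add: min_weight_members_def)
      have "weight w N < weight w M"
        using False min M less.prems by (force simp: min_weight_members_def)
      then have inF: "weight w N \<in> ?W F" using N by (auto simp: min_weight_members_def)
      \<comment> \<open>A matching of this weight containing \<open>insert e F\<close> would be a
        minimizer for \<open>F\<close> that contains \<open>e\<close>.\<close>
      have notin: "weight w N \<notin> ?W (insert e F)"
      proof
        assume "weight w N \<in> ?W (insert e F)"
        then obtain N' where N': "N' \<in> ?P (insert e F)" "weight w N' = weight w N" by auto
        then have "N' \<in> min_weight_members w (?P F)" using min by (auto simp: min_weight_members_def)
        then show False using e(2) N'(1) by blast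
      qed
      have "?W (insert e F) \<subseteq> ?W F" by auto
      with inF notin have less_W: "card (?W (insert e F)) < card (?W F)"
        using finW[of F] by (intro psubset_card_mono) blast+
      obtain F' where F': "F' \<subseteq> M" "card F' \<le> card (insert e F) + card (?W (insert e F))"
          "M \<in> min_weight_members w (?P F')"
        using less.hyps[OF less_W] e(1) less.prems by auto
      \<comment> \<open>For infinite \<open>F\<close> both cardinalities have the default value
        0.\<close>
      have "card (insert e F) \<le> Suc (card F)"
        by (cases "finite F") (simp_all add: card_insert_if)
      then have "card F' \<le> card F + card (?W F)" using F'(2) less_W by linarith
      then show ?thesis using F' by blast
    qed
  qed
qed

section \<open>Ranks and weight values\<close>

text \<open>A perfect matching lighter than \<open>M\<close> must already have an earlier rank, and
  each of the \<open>l - 1\<close> earlier ranks carries at most one weight.\<close>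

lemma card_smaller_weights:
  assumes "l \<ge> 1" "M \<in> lth_smallest_pms V E w l"
  shows "M \<in> perfect_matchings V E"
    and "card {x \<in> weight w ` perfect_matchings V E. x < weight w M} \<le> l - 1"
proof -
  let ?L = "lth_smallest_pms V E w"
  have M: "M \<in> min_weight_members w (perfect_matchings V E - (\<Union>l'\<in>{1..<l}. ?L l'))"
    using assms by (simp add: lth_smallest_pms.simps[of V E w l])
  then show "M \<in> perfect_matchings V E" by (simp add: min_weight_members_def)
  have same: "weight w N = weight w N'" if "N \<in> ?L i" "N' \<in> ?L i" for N N' i
  proof -
    have "?L i \<subseteq> min_weight_members w (perfect_matchings V E - (\<Union>l'\<in>{1..<i}. ?L l'))"
      by (subst lth_smallest_pms.simps) auto
    with that have "weight w N \<le> weight w N'" "weight w N' \<le> weight w N"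
      unfolding min_weight_members_def by blast+
    then show ?thesis by simp
  qed
  \<comment> \<open>Each earlier rank is sent to the weight of a chosen member. An empty rank yields
    an arbitrary value, which is harmless because only an inclusion is claimed.\<close>
  have "{x \<in> weight w ` perfect_matchings V E. x < weight w M}
      \<subseteq> (\<lambda>i. weight w (SOME N. N \<in> ?L i)) ` {1..<l}"
  proof
    fix x assume "x \<in> {x \<in> weight w ` perfect_matchings V E. x < weight w M}"
    then obtain N where N: "N \<in> perfect_matchings V E" "x = weight w N" "weight w N < weight w M"
      by blast
    have "N \<in> (\<Union>l'\<in>{1..<l}. ?L l')"
    proof (rule ccontr)
      assume "N \<notin> (\<Union>l'\<in>{1..<l}. ?L l')"
      then have "weight w M \<le> weight w N"
        using M N(1) unfolding min_weight_members_def by blast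
      then show False using N(3) by simp
    qed
    then obtain i where i: "i \<in> {1..<l}" "N \<in> ?L i" by blast
    have "x = weight w (SOME N. N \<in> ?L i)"
      unfolding N(2) by (rule same[OF i(2)]) (rule someI[of "\<lambda>N. N \<in> ?L i", OF i(2)])
    then show "x \<in> (\<lambda>i. weight w (SOME N. N \<in> ?L i)) ` {1..<l}" using i(1) by blast
  qed
  then have "card {x \<in> weight w ` perfect_matchings V E. x < weight w M}
      \<le> card ((\<lambda>i. weight w (SOME N. N \<in> ?L i)) ` {1..<l})"
    by (rule card_mono[rotated]) simp
  also have "\<dots> \<le> l - 1"
    using card_image_le[of "{1..<l}" "\<lambda>i. weight w (SOME N. N \<in> ?L i)"] by simp
  finally show "card {x \<in> weight w ` perfect_matchings V E. x < weight w M} \<le> l - 1" .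
qed

theorem mainTheorem2:
  fixes V :: "'a set" and E :: "'a set set" and w :: "'a set \<Rightarrow> int"
    and l :: nat and M :: "'a set set"
  assumes "simple_graph V E"
    and "bipartite V E"
    and "l \<ge> 1"
    and "M \<in> lth_smallest_pms V E w l"
  shows "\<exists>F. F \<subseteq> E \<and> card F \<le> l - 1 \<and>
    {M' \<in> perfect_matchings V E. F \<subseteq> M'} \<noteq> {} \<and>
    weight w M = Min (weight w ` {M' \<in> perfect_matchings V E. F \<subseteq> M'})"
proof -
  note M = card_smaller_weights[OF assms(3,4)]
  \<comment> \<open>Starting from the empty set, all perfect matchings compete, so at most
    \<open>l - 1\<close> weight values have to be removed.\<close>
  obtain F where F: "F \<subseteq> M" "card F \<le> l - 1"
    and min: "M \<in> min_weight_members w {M' \<in> perfect_matchings V E. F \<subseteq> M'}"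
    using forcing_edges_exist[OF assms(1,2) M(1), of "{}" w] M(2) by (auto intro: order_trans)
  have "finite {M' \<in> perfect_matchings V E. F \<subseteq> M'}"
    using finite_perfect_matchings[OF simple_graph_finite_edges[OF assms(1)]] by simp
  then have "Min (weight w ` {M' \<in> perfect_matchings V E. F \<subseteq> M'}) = weight w M"
    using min by (intro Min_eqI) (auto simp: min_weight_members_def)
  moreover have "F \<subseteq> E" using F(1) perfect_matchings_subset[OF M(1)] by blast
  ultimately show ?thesis using F M(1) by (intro exI[of _ F]) auto
qed

end
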